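(* Let $m\ge 2$ and let $h_\omega$ be the infinite $m$-bonacci word. The sequence of lengths of the maximal blocks of consecutive $1$'s in the oc-sequence $oc(h_\omega)$ is exactly $|h_i|$, for all $i\ge 0$.
   Context: Fix $m\ge 2$ and $A_m=\{0,1,\ldots,m-1\}$. The morphism $\varphi_m:A_m^*\to A_m^*$ is given by $\varphi_m(i)=0(i+1)$ (the two-letter word with letters $0$ and $i+1$) for $0\le i\le m-2$ and $\varphi_m(m-1)=0$. Put $h_n=\varphi_m^n(0)$ for $n\ge 0$; the infinite $m$-bonacci word $h_\omega$ is the fixed point of $\varphi_m$ starting with $0$. $|w|$ is the length of a word $w$. A word $x$ is a border of $w$ if it is nonempty and both a prefix and a suffix of $w$. A nonempty finite word $w$ is closed if it is a single letter or it has a border $x$ that occurs exactly twice in $w$ (as a prefix and as a suffix, with no other occurrence); otherwise it is open. The oc-sequence $oc(\boldsymbol{w})$ of an infinite word $\boldsymbol{w}$ is the binary sequence $x_1x_2x_3\cdots$ with $x_n=1$ if the prefix of length $n$ of $\boldsymbol{w}$ is closed and $x_n=0$ if it is open.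
   Formalization: The sequence of block lengths is proved to be 1, |h_0|, |h_1|, |h_2|, …: the one-letter prefix gives an additional first block of length 1, so the claim as printed is off by this block (for m=2 the oc-sequence starts 1010110, with blocks 1, 1, 2, while |h_1|=2). *)

theory Defs
  imports "HOL-Library.Sublist" "HOL-Library.Stream"
begin

(* Letters are natural numbers and the alphabet is {..<m}.  The image of a letter outside the
   alphabet is irrelevant. *)
definition bonacci_letter :: "nat \<Rightarrow> nat \<Rightarrow> nat list" where
  "bonacci_letter m i = (if i + 1 < m then [0, i + 1] else [0])"

definition bonacci_morphism :: "nat \<Rightarrow> nat list \<Rightarrow> nat list" where
  "bonacci_morphism m w = concat (map (bonacci_letter m) w)"

definition bonacci_finite :: "nat \<Rightarrow> nat \<Rightarrow> nat list" where
  "bonacci_finite m n = (bonacci_morphism m ^^ n) [0]"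

(* flat concatenates a stream of nonempty words, so flat (smap (bonacci_letter m) w) is the
   image of the infinite word w under the morphism. *)
definition is_bonacci_word :: "nat \<Rightarrow> nat stream \<Rightarrow> bool" where
  "is_bonacci_word m w \<longleftrightarrow>
     w \<in> streams {..<m} \<and> shd w = 0 \<and> flat (smap (bonacci_letter m) w) = w"

definition bonacci_word :: "nat \<Rightarrow> nat stream" where
  "bonacci_word m = (THE w. is_bonacci_word m w)"

definition border :: "'a list \<Rightarrow> 'a list \<Rightarrow> bool" where
  "border x w \<longleftrightarrow> x \<noteq> [] \<and> prefix x w \<and> suffix x w"

definition occurrences :: "'a list \<Rightarrow> 'a list \<Rightarrow> nat set" where
  "occurrences x w = {i. i \<le> length w \<and> prefix x (drop i w)}"

(* The border x = w is not excluded explicitly: it occurs only once in w. *)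
definition closed_word :: "'a list \<Rightarrow> bool" where
  "closed_word w \<longleftrightarrow> w \<noteq> [] \<and>
     (length w = 1 \<or> (\<exists>x. border x w \<and> card (occurrences x w) = 2))"

(* Position k of the stream corresponds to the prefix of length k + 1.  As a single letter is
   closed by convention, position 0 is always 1. *)
definition oc :: "'a stream \<Rightarrow> nat stream" where
  "oc w = smap (\<lambda>n. if closed_word (stake n w) then 1 else 0) (fromN 1)"

(* l consecutive 1's starting at position a, extendable neither to the left nor to the right *)
definition maximal_block :: "nat stream \<Rightarrow> nat \<Rightarrow> nat \<Rightarrow> bool" where
  "maximal_block s a l \<longleftrightarrow>
     l > 0 \<and> (\<forall>j. a \<le> j \<and> j < a + l \<longrightarrow> s !! j = 1) \<and>
     (a = 0 \<or> s !! (a - 1) \<noteq> 1) \<and> s !! (a + l) \<noteq> 1"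

(* p enumerates from left to right the starting positions of all maximal blocks of 1's in s, and
   the i-th of these blocks has length b !! i.  In particular there are infinitely many blocks,
   all of them finite. *)
definition block_lengths :: "nat stream \<Rightarrow> nat stream \<Rightarrow> bool" where
  "block_lengths s b \<longleftrightarrow>
     (\<exists>p :: nat \<Rightarrow> nat. strict_mono p \<and> range p = {a. \<exists>l. maximal_block s a l} \<and>
        (\<forall>i. maximal_block s (p i) (b !! i)))"

end

theory Submission
  imports Defs
begin

text \<open>
  Let \<open>r b\<close> be the first positive position at which the prefix of length \<open>b\<close> of an infinite word
  occurs again. A prefix of length \<open>n\<close> is closed iff \<open>n = b + r b\<close> for some \<open>b \<ge> 0\<close>, where \<open>b = 0\<close>
  accounts for the single letter. As \<open>r\<close> is nondecreasing, the blocks of \<open>1\<close>'s in the oc-sequence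
  are the level sets of \<open>r\<close>, shifted.

  Write \<open>\<phi>\<close> for the morphism and let \<open>P\<^sub>0\<close> be empty and \<open>P\<^sub>k\<^sub>+\<^sub>1 = \<phi>(P\<^sub>k) 0 = h\<^sub>k P\<^sub>k\<close>. A return of a nonempty
  prefix starts with \<open>0\<close>, hence at the start of an image of a letter, and desubstitution shows by
  induction that \<open>P\<^sub>k\<close> occurs at \<open>|h\<^sub>k|\<close>, while no prefix longer than \<open>P\<^sub>k\<close> occurs at a position
  strictly between \<open>0\<close> and \<open>|h\<^sub>k\<^sub>+\<^sub>1|\<close>. So \<open>r\<close> equals \<open>|h\<^sub>k\<^sub>+\<^sub>1|\<close> exactly on \<open>|P\<^sub>k| < b \<le> |P\<^sub>k\<^sub>+\<^sub>1|\<close>, which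
  is a level set of size \<open>|h\<^sub>k|\<close>.
\<close>

section \<open>Closed prefixes and first returns\<close>

text \<open>A relation and not a function, because a prefix of an arbitrary stream need not
  recur.\<close>

definition first_return :: "'a stream \<Rightarrow> nat \<Rightarrow> nat \<Rightarrow> bool" where
  "first_return w b j \<longleftrightarrow> 0 < j \<and> stake b (sdrop j w) = stake b w \<and>
     (\<forall>i. 0 < i \<and> i < j \<longrightarrow> stake b (sdrop i w) \<noteq> stake b w)"

lemma prefix_iff_take: "prefix u v \<longleftrightarrow> take (length u) v = u"
  by (metis append_eq_conv_conj prefix_def take_is_prefix)

lemma occurrences_stake:
  "occurrences (stake b w) (stake n w) =
    {i. i + b \<le> n \<and> stake b (sdrop i w) = stake b w}" (is "?L = ?R")
proof -
  have "stake (min b (n - i)) (sdrop i w) = stake b w \<longleftrightarrow>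
      i + b \<le> n \<and> stake b (sdrop i w) = stake b w" if "i \<le> n" for i
  proof (cases "i + b \<le> n")
    case True
    then show ?thesis by (simp add: min_def le_diff_conv2 that add.commute)
  next
    case False
    \<comment> \<open>A window overrunning the prefix is truncated, hence too short to be an
      occurrence.\<close>
    then have "length (stake (min b (n - i)) (sdrop i w)) \<noteq> length (stake b w)"
      using that unfolding length_stake by linarith
    with False show ?thesis by metis
  qed
  then show ?thesis
    unfolding occurrences_def prefix_iff_take length_stake drop_stake take_stake by auto
qed

lemma border_stake:
  "border x (stake n w) \<longleftrightarrow>
    (\<exists>b. 0 < b \<and> b \<le> n \<and> x = stake b w \<and> stake b (sdrop (n - b) w) = stake b w)"
proof
  assume "border x (stake n w)"
  then obtain u v where x: "x \<noteq> []" and u: "stake n w = x @ u" and v: "stake n w = v @ x"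
    unfolding border_def prefix_def suffix_def by blast
  have len: "length x + length u = n" "length v + length x = n"
    using arg_cong[OF u, of length] arg_cong[OF v, of length] by simp_all
  have "stake (length x) w = x"
    using arg_cong[OF u, of "take (length x)"] len by (simp add: take_stake min_def)
  moreover have "stake (length x) (sdrop (n - length x) w) = x"
    using arg_cong[OF v, of "drop (length v)"] by (simp add: drop_stake flip: len(2))
  ultimately show "\<exists>b. 0 < b \<and> b \<le> n \<and> x = stake b w \<and> stake b (sdrop (n - b) w) = stake b w"
    using x len by (intro exI[of _ "length x"]) simp
next
  assume "\<exists>b. 0 < b \<and> b \<le> n \<and> x = stake b w \<and> stake b (sdrop (n - b) w) = stake b w"
  then obtain b where b: "0 < b" "b \<le> n" "x = stake b w" "stake b (sdrop (n - b) w) = stake b w"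
    by blast
  then have "x = take b (stake n w)" "x = drop (n - b) (stake n w)"
    by (simp_all add: take_stake drop_stake min_def)
  with b(1,3) show "border x (stake n w)"
    unfolding border_def
    by (metis length_stake list.size(3) less_irrefl suffix_drop take_is_prefix)
qed

text \<open>Applied to the occurrences of a border: the first is at \<open>0\<close>, the last at
  \<open>j\<close>.\<close>

lemma card_eq_2_iff_pair:
  assumes "0 \<in> S" "j \<in> S" "\<forall>i\<in>S. i \<le> (j::nat)"
  shows "card S = 2 \<longleftrightarrow> 0 < j \<and> (\<forall>i. 0 < i \<and> i < j \<longrightarrow> i \<notin> S)"
proof
  assume c: "card S = 2"
  then obtain x y where S: "S = {x, y}" "x \<noteq> y" by (auto simp: card_2_iff)
  with assms show "0 < j \<and> (\<forall>i. 0 < i \<and> i < j \<longrightarrow> i \<notin> S)" by auto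
next
  assume a: "0 < j \<and> (\<forall>i. 0 < i \<and> i < j \<longrightarrow> i \<notin> S)"
  with assms have "S = {0, j}" by (auto simp: order.order_iff_strict)
  with a show "card S = 2" by auto
qed

text \<open>A border of length \<open>b\<close> ends the word from position \<open>j = n - b\<close>
  on; having no third occurrence means that \<open>j\<close> is the first return.\<close>

lemma closed_stake_iff:
  "closed_word (stake n w) \<longleftrightarrow> (\<exists>b j. n = b + j \<and> first_return w b j)"
proof -
  have card: "card (occurrences (stake b w) (stake (b + j) w)) = 2 \<longleftrightarrow> first_return w b j"
    if "stake b (sdrop j w) = stake b w" for b j
    using that unfolding first_return_def
    by (subst card_eq_2_iff_pair[where j = j]) (auto simp: occurrences_stake)
  show ?thesis
  proof
    assume c: "closed_word (stake n w)"
    show "\<exists>b j. n = b + j \<and> first_return w b j"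
    proof (cases "n = 1")
      case True
      \<comment> \<open>The empty prefix returns after one letter.\<close>
      then show ?thesis by (intro exI[of _ 0] exI[of _ 1]) (auto simp: first_return_def)
    next
      case False
      with c obtain b where "b \<le> n" "stake b (sdrop (n - b) w) = stake b w"
        "card (occurrences (stake b w) (stake n w)) = 2"
        by (auto simp: closed_word_def border_stake)
      with card[of b "n - b"] show ?thesis by (intro exI[of _ b] exI[of _ "n - b"]) auto
    qed
  next
    assume "\<exists>b j. n = b + j \<and> first_return w b j"
    then obtain b j where n: "n = b + j" and r: "first_return w b j" by blast
    then have j: "0 < j" "stake b (sdrop j w) = stake b w" by (auto simp: first_return_def)
    show "closed_word (stake n w)"
    proof (cases b)
      case 0
      with r have "j = 1"
        by (auto simp: first_return_def dest!: spec[of _ 1])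
      with 0 n show ?thesis by (simp add: closed_word_def)
    next
      case Suc
      then have "0 < b" by simp
      with n j have "border (stake b w) (stake n w)"
        unfolding border_stake by (intro exI[of _ b]) simp
      then show ?thesis
        using card[of b j] r n j unfolding closed_word_def
        by (metis add_is_0 length_stake less_numeral_extra(3) list.size(3))
    qed
  qed
qed

lemma oc_snth: "oc w !! a = (if closed_word (stake (Suc a) w) then 1 else 0)"
  by (simp add: oc_def)

lemma first_return_unique: "first_return w b i \<Longrightarrow> first_return w b j \<Longrightarrow> i = j"
  unfolding first_return_def by (metis linorder_neqE_nat)

section \<open>Blocks of a sequence given by separated intervals\<close>

text \<open>Strictness in \<open>sep\<close> leaves at least one position between neighbouring
  intervals, so they cannot merge into one block.\<close>

lemma block_lengths_intervals:
  fixes p l :: "nat \<Rightarrow> nat"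
  assumes ones: "\<And>a. s !! a = 1 \<longleftrightarrow> (\<exists>k. p k \<le> a \<and> a < p k + l k)"
    and pos: "\<And>k. 0 < l k" and sep: "\<And>k. p k + l k < p (Suc k)"
  shows "block_lengths s (smap l nats)"
proof -
  have mono: "strict_mono p"
    by (rule strict_mono_Suc_iff[THEN iffD2]) (metis sep add_lessD1)
  have sep': "p i + l i < p k" if "i < k" for i k
    using sep[of i] strict_mono_less_eq[OF mono, of "Suc i" k] that by simp
  have "s !! (p k - 1) \<noteq> 1" if "p k \<noteq> 0" for k
  proof
    assume "s !! (p k - 1) = 1"
    then obtain i where "p i \<le> p k - 1" "p k - 1 < p i + l i" using ones by blast
    with that sep'[of i k] sep'[of k i] pos[of k] show False
      by (cases i k rule: linorder_cases) auto
  qed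
  moreover have "s !! (p k + l k) \<noteq> 1" for k
  proof
    assume "s !! (p k + l k) = 1"
    then obtain i where "p i \<le> p k + l k" "p k + l k < p i + l i" using ones by blast
    with sep'[of i k] sep'[of k i] show False by (cases i k rule: linorder_cases) auto
  qed
  ultimately have block: "maximal_block s (p k) (l k)" for k
    using ones pos unfolding maximal_block_def by blast
  have "\<exists>k. a = p k" if "maximal_block s a d" for a d
  proof -
    have "s !! a = 1" and left: "a = 0 \<or> s !! (a - 1) \<noteq> 1"
      using that by (auto simp: maximal_block_def)
    then obtain k where k: "p k \<le> a" "a < p k + l k" using ones by blast
    have "a = p k"
    proof (rule ccontr)
      assume "a \<noteq> p k"
      with k have "p k \<le> a - 1 \<and> a - 1 < p k + l k" "a \<noteq> 0" by auto
      with left ones show False by blast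
    qed
    then show ?thesis ..
  qed
  then have "range p = {a. \<exists>l. maximal_block s a l}" using block by blast
  with mono block show ?thesis unfolding block_lengths_def by auto
qed

section \<open>The morphism\<close>

lemma bonacci_letter_neq_Nil [simp]: "bonacci_letter m i \<noteq> []"
  by (simp add: bonacci_letter_def)

lemma bonacci_morphism_simps [simp]:
  "bonacci_morphism m [] = []"
  "bonacci_morphism m (i # u) = bonacci_letter m i @ bonacci_morphism m u"
  "bonacci_morphism m (u @ v) = bonacci_morphism m u @ bonacci_morphism m v"
  by (simp_all add: bonacci_morphism_def)

lemma bonacci_finite_simps [simp]:
  "bonacci_finite m 0 = [0]"
  "bonacci_finite m (Suc n) = bonacci_morphism m (bonacci_finite m n)"
  by (simp_all add: bonacci_finite_def)

section \<open>Images of streams: splitting, positions of \<open>0\<close>, decoding\<close>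

abbreviation bonacci_image :: "nat \<Rightarrow> nat stream \<Rightarrow> nat stream" where
  "bonacci_image m s \<equiv> flat (smap (bonacci_letter m) s)"

lemma bonacci_image_unfold:
  "bonacci_image m s = bonacci_letter m (shd s) @- bonacci_image m (stl s)"
  by (metis bonacci_letter_neq_Nil flat_unfold stream.map_sel)

lemma shd_bonacci_image [simp]: "shd (bonacci_image m s) = 0"
  by (subst bonacci_image_unfold) (simp add: bonacci_letter_def)

lemma bonacci_image_split:
  "bonacci_image m s = bonacci_morphism m (stake n s) @- bonacci_image m (sdrop n s)"
proof (induction n arbitrary: s)
  case (Suc n)
  show ?case by (subst bonacci_image_unfold, subst Suc.IH) simp
qed simp

lemma stake_bonacci_image:
  "stake (length (bonacci_morphism m (stake n s))) (bonacci_image m s) = bonacci_morphism m (stake n s)"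
  by (simp add: bonacci_image_split[of m s n] stake_shift)

lemma sdrop_bonacci_image:
  "sdrop (length (bonacci_morphism m (stake n s))) (bonacci_image m s) = bonacci_image m (sdrop n s)"
  by (subst bonacci_image_split[of m s n]) (simp add: sdrop_shift)

lemma bonacci_image_snth_1:
  "bonacci_image m s !! 1 = (if shd s + 1 < m then shd s + 1 else 0)"
  by (subst bonacci_image_unfold) (simp add: bonacci_letter_def)

text \<open>The second letter of a two-letter image is never \<open>0\<close>, so each
  \<open>0\<close> marks the start of an image. This lets a return be pulled back through the
  morphism.\<close>

lemma bonacci_image_zero_position:
  assumes "bonacci_image m s !! j = 0" "j < length (bonacci_morphism m (stake n s))"
  obtains i where "i < n" "j = length (bonacci_morphism m (stake i s))"
proof -
  have "\<exists>i<n. j = length (bonacci_morphism m (stake i s))"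
    using assms
  proof (induction n arbitrary: s j)
    case (Suc n)
    let ?c = "length (bonacci_letter m (shd s))"
    show ?case
    proof (cases "j < ?c")
      case True
      have "bonacci_letter m (shd s) ! j = 0"
        using Suc.prems(1) True by (subst (asm) bonacci_image_unfold) simp
      with True have "j = 0" by (auto simp: bonacci_letter_def less_Suc_eq split: if_splits)
      then show ?thesis by auto
    next
      case False
      have "bonacci_image m (stl s) !! (j - ?c) = 0"
        using Suc.prems(1) False by (subst (asm) bonacci_image_unfold) simp
      moreover have "j - ?c < length (bonacci_morphism m (stake n (stl s)))"
        using Suc.prems(2) False by simp
      ultimately obtain i where "i < n" "j - ?c = length (bonacci_morphism m (stake i (stl s)))"
        using Suc.IH by blast
      with False show ?thesis by (intro exI[of _ "Suc i"]) simp
    qed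
  qed simp
  with that show ?thesis by blast
qed

text \<open>Two letters past the image of the common prefix suffice to decode the next letter: its image
  starts with \<open>0\<close>, and what follows is the incremented letter, or the next \<open>0\<close> for the letter
  \<open>m - 1\<close>.\<close>

lemma bonacci_image_decode:
  assumes "s \<in> streams {..<m}" "t \<in> streams {..<m}"
    and "stake (length (bonacci_morphism m (stake c s)) + 2) (bonacci_image m t) =
      stake (length (bonacci_morphism m (stake c s)) + 2) (bonacci_image m s)"
  shows "stake (Suc c) t = stake (Suc c) s"
  using assms
proof (induction c arbitrary: s t)
  case (0 s t)
  have "bonacci_image m t !! 1 = bonacci_image m s !! 1"
    using arg_cong[OF 0(3), of "\<lambda>u. u ! 1"] by simp
  \<comment> \<open>Within the alphabet only \<open>m - 1\<close> puts \<open>0\<close> at position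
    1, so that position determines the first letter.\<close>
  moreover have "shd s < m" "shd t < m"
    using 0 by (auto elim: streams.cases)
  ultimately show ?case
    unfolding bonacci_image_snth_1 by (auto split: if_splits)
next
  case (Suc c s t)
  let ?n = "length (bonacci_morphism m (stake c (stl s))) + 2"
  have "bonacci_image m t !! 1 = bonacci_image m s !! 1"
    using arg_cong[OF Suc.prems(3), of "\<lambda>u. u ! 1"] by simp
  moreover have mem: "shd s < m" "shd t < m" "stl s \<in> streams {..<m}" "stl t \<in> streams {..<m}"
    using Suc.prems by (auto elim: streams.cases)
  ultimately have eq: "shd t = shd s"
    unfolding bonacci_image_snth_1 by (auto split: if_splits)
  have len: "length (bonacci_morphism m (stake (Suc c) s)) + 2
      = length (bonacci_letter m (shd s)) + ?n" by simp
  have "stake ?n (bonacci_image m (stl t)) = stake ?n (bonacci_image m (stl s))"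
    using arg_cong[OF Suc.prems(3)[unfolded len], of "drop (length (bonacci_letter m (shd s)))"]
    unfolding drop_stake
    by (simp add: bonacci_image_unfold[of m s] bonacci_image_unfold[of m t] eq sdrop_shift)
  from Suc.IH[OF mem(3,4) this] eq show ?case by simp
qed

section \<open>Growth and prefix chain of the words \<open>h_n\<close>\<close>

lemma length_bonacci_morphism_ge: "length u \<le> length (bonacci_morphism m u)"
  by (induction u) (auto simp: bonacci_letter_def)

lemma bonacci_morphism_less:
  "set u \<subseteq> {..<m} \<Longrightarrow> 0 < m \<Longrightarrow> set (bonacci_morphism m u) \<subseteq> {..<m}"
  by (induction u) (auto simp: bonacci_letter_def)

lemma bonacci_finite_less: "0 < m \<Longrightarrow> set (bonacci_finite m n) \<subseteq> {..<m}"
  by (induction n) (simp_all add: bonacci_morphism_less)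

lemma bonacci_finite_Cons: "\<exists>u. bonacci_finite m n = 0 # u"
  by (induction n) (auto simp: bonacci_letter_def)

text \<open>No image is empty, and the leading \<open>0\<close> becomes two letters since
  \<open>m \<ge> 2\<close>.\<close>

lemma length_bonacci_finite_less_Suc:
  assumes "2 \<le> m"
  shows "length (bonacci_finite m n) < length (bonacci_finite m (Suc n))"
proof -
  obtain u where "bonacci_finite m n = 0 # u" using bonacci_finite_Cons by blast
  then show ?thesis
    using assms length_bonacci_morphism_ge[of u m] by (simp add: bonacci_letter_def)
qed

lemma length_bonacci_finite_gt: "2 \<le> m \<Longrightarrow> n < length (bonacci_finite m n)"
proof (induction n)
  case (Suc n)
  then show ?case using length_bonacci_finite_less_Suc[of m n] by linarith
qed simp

lemma prefix_bonacci_morphism: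
  "prefix u v \<Longrightarrow> prefix (bonacci_morphism m u) (bonacci_morphism m v)"
  by (auto simp: prefix_def)

lemma prefix_bonacci_finite_Suc: "prefix (bonacci_finite m n) (bonacci_finite m (Suc n))"
proof (induction n)
  case (Suc n)
  then show ?case
    using prefix_bonacci_morphism bonacci_finite_simps(2) by metis
qed (simp add: bonacci_letter_def)

lemma prefix_bonacci_finite: "i \<le> n \<Longrightarrow> prefix (bonacci_finite m i) (bonacci_finite m n)"
  by (induction n rule: dec_induct) (blast intro: prefix_order.trans prefix_bonacci_finite_Suc)+

section \<open>The infinite word\<close>

lemma stream_eq_iff_snth: "s = t \<longleftrightarrow> (\<forall>n. s !! n = t !! n)"
  using smap_alt[of "\<lambda>x. x" s t] by (simp add: stream.map_ident)

lemma stake_eq_iff: "stake n s = stake n t \<longleftrightarrow> (\<forall>i<n. s !! i = t !! i)"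
  by (auto simp: list_eq_iff_nth_eq)

lemma stake_eq_mono: "stake c s = stake c t \<Longrightarrow> b \<le> c \<Longrightarrow> stake b s = stake b t"
  by (auto simp: stake_eq_iff)

text \<open>The image of a prefix of \<open>w\<close> is a prefix of the image of \<open>w\<close>,
  which is \<open>w\<close> itself.\<close>

lemma stake_is_bonacci_word:
  assumes "is_bonacci_word m w"
  shows "stake (length (bonacci_finite m n)) w = bonacci_finite m n"
proof (induction n)
  case 0
  then show ?case using assms by (simp add: is_bonacci_word_def)
next
  case (Suc n)
  have "bonacci_image m w = w" using assms by (simp add: is_bonacci_word_def)
  with stake_bonacci_image[of m "length (bonacci_finite m n)" w] Suc show ?case by simp
qed

lemma is_bonacci_word_unique:
  assumes "2 \<le> m" "is_bonacci_word m v" "is_bonacci_word m w"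
  shows "v = w"
proof -
  have "v !! n = w !! n" for n
    using assms stake_is_bonacci_word[of m v n] stake_is_bonacci_word[of m w n]
      length_bonacci_finite_gt[of m n] by (metis stake_nth)
  then show ?thesis by (simp add: stream_eq_iff_snth)
qed

lemma is_bonacci_word_exists:
  assumes m: "2 \<le> m"
  shows "\<exists>w. is_bonacci_word m w"
proof -
  \<comment> \<open>Diagonal limit: \<open>h_i\<close> has more than \<open>i\<close> letters, and
    the \<open>h_n\<close> form a prefix chain, so every longer \<open>h_n\<close> has the same
    letter at \<open>i\<close>.\<close>
  define w where "w = smap (\<lambda>i. bonacci_finite m i ! i) nats"
  have stake: "stake (length (bonacci_finite m n)) w = bonacci_finite m n" for n
  proof (rule nth_equalityI)
    fix i
    assume "i < length (stake (length (bonacci_finite m n)) w)"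
    then have i: "i < length (bonacci_finite m n)" by simp
    have "bonacci_finite m i ! i = bonacci_finite m n ! i"
      using i length_bonacci_finite_gt[OF m, of i] prefix_bonacci_finite[of i n m]
        prefix_bonacci_finite[of n i m]
      by (metis nat_le_linear nth_append prefix_def)
    with i show "stake (length (bonacci_finite m n)) w ! i = bonacci_finite m n ! i"
      by (simp add: w_def)
  qed simp
  have "bonacci_image m w !! n = w !! n" for n
  proof -
    have "stake (length (bonacci_finite m (Suc n))) (bonacci_image m w)
        = stake (length (bonacci_finite m (Suc n))) w"
      using stake_bonacci_image[of m "length (bonacci_finite m n)" w] stake[of n] stake[of "Suc n"]
      by simp
    moreover have "n < length (bonacci_finite m (Suc n))"
      using length_bonacci_finite_gt[OF m, of "Suc n"] by linarith
    ultimately show ?thesis using stake_eq_iff by blast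
  qed
  then have "bonacci_image m w = w" by (simp add: stream_eq_iff_snth)
  moreover have "w \<in> streams {..<m}"
    unfolding streams_iff_snth
  proof
    fix n
    have "bonacci_finite m n ! n \<in> {..<m}"
      using m bonacci_finite_less[of m n] nth_mem[OF length_bonacci_finite_gt[OF m]] by auto
    then show "w !! n \<in> {..<m}" by (simp add: w_def)
  qed
  moreover have "shd w = 0" by (simp add: w_def)
  ultimately show ?thesis unfolding is_bonacci_word_def by blast
qed

lemma bonacci_word: "2 \<le> m \<Longrightarrow> is_bonacci_word m (bonacci_word m)"
  unfolding bonacci_word_def
  by (rule theI') (blast intro: is_bonacci_word_exists is_bonacci_word_unique)

section \<open>First returns in the infinite word\<close>

text \<open>The words \<open>P_k\<close> of the overview; they are palindromic prefixes of the
  infinite word.\<close>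

primrec bonacci_central :: "nat \<Rightarrow> nat \<Rightarrow> nat list" where
  "bonacci_central m 0 = []"
| "bonacci_central m (Suc k) = bonacci_morphism m (bonacci_central m k) @ [0]"

text \<open>Applying the morphism to \<open>h_k P_k\<close> and appending \<open>0\<close> gives
  \<open>h_(k+1) P_(k+1)\<close>. The lengths \<open>|P_(k+1)| - |P_k| = |h_k|\<close> become the
  block lengths.\<close>

lemma bonacci_central_Suc_eq:
  "bonacci_central m (Suc k) = bonacci_finite m k @ bonacci_central m k"
proof (induction k)
  case (Suc k)
  have "bonacci_central m (Suc (Suc k)) = bonacci_morphism m (bonacci_central m (Suc k)) @ [0]"
    by simp
  also have "\<dots> = bonacci_finite m (Suc k) @ bonacci_morphism m (bonacci_central m k) @ [0]"
    unfolding Suc by simp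
  finally show ?case by simp
qed simp

lemma length_bonacci_central_Suc:
  "length (bonacci_central m (Suc k)) = length (bonacci_finite m k) + length (bonacci_central m k)"
  by (simp only: bonacci_central_Suc_eq length_append)

text \<open>The final \<open>0\<close> comes for free: whatever letter follows \<open>P_k\<close> in
  \<open>s\<close>, its image starts with \<open>0\<close>. Used for \<open>w\<close> and for
  \<open>w\<close> shifted by \<open>|h_k|\<close>.\<close>

lemma stake_bonacci_central_step:
  assumes "stake (length (bonacci_central m k)) s = bonacci_central m k"
  shows "stake (length (bonacci_central m (Suc k))) (bonacci_image m s) = bonacci_central m (Suc k)"
  using assms
  by (subst bonacci_image_split[of m s "length (bonacci_central m k)"])
    (simp add: stake_shift bonacci_letter_def)

context
  fixes m :: nat and w :: "nat stream"
  assumes m: "2 \<le> m" and w: "is_bonacci_word m w"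
begin

lemma image_word: "bonacci_image m w = w"
  using w by (simp add: is_bonacci_word_def)

lemma sdrop_length_bonacci_finite_Suc:
  "sdrop (length (bonacci_finite m (Suc k))) w = bonacci_image m (sdrop (length (bonacci_finite m k)) w)"
  using sdrop_bonacci_image[of m "length (bonacci_finite m k)" w]
  by (simp add: stake_is_bonacci_word[OF w] image_word)

lemma stake_bonacci_central: "stake (length (bonacci_central m k)) w = bonacci_central m k"
proof (induction k)
  case (Suc k)
  from stake_bonacci_central_step[OF this] show ?case unfolding image_word .
qed simp

lemma bonacci_central_returns:
  "stake (length (bonacci_central m k)) (sdrop (length (bonacci_finite m k)) w) = bonacci_central m k"
proof (induction k)
  case (Suc k)
  from stake_bonacci_central_step[OF this] show ?case
    unfolding sdrop_length_bonacci_finite_Suc .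
qed simp

text \<open>A return at \<open>j\<close> starts with \<open>0\<close>, so \<open>j\<close> is the
  length of the image of a prefix of some length \<open>i\<close>; decoding yields a shorter return
  at \<open>i\<close>, one level down. At the bottom, \<open>w\<close> starts with
  \<open>0 1\<close>, which excludes \<open>j = 1\<close>.\<close>

lemma no_early_return:
  assumes "0 < j" "j < length (bonacci_finite m (Suc k))"
  shows "stake (Suc (length (bonacci_central m k))) (sdrop j w)
    \<noteq> stake (Suc (length (bonacci_central m k))) w"
  using assms
proof (induction k arbitrary: j)
  case 0
  then have "j = 1" using m by (simp add: bonacci_letter_def)
  moreover have "w !! 1 = 1" "shd w = 0"
    using bonacci_image_snth_1[of m w] m w image_word by (auto simp: is_bonacci_word_def)
  ultimately show ?case by simp
next
  case (Suc k)
  show ?case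
  proof
    assume ret: "stake (Suc (length (bonacci_central m (Suc k)))) (sdrop j w)
      = stake (Suc (length (bonacci_central m (Suc k)))) w"
    let ?n = "length (bonacci_finite m (Suc k))" and ?c = "length (bonacci_central m k)"
    have "bonacci_image m w !! j = 0"
      using ret w by (simp add: image_word is_bonacci_word_def)
    moreover have "j < length (bonacci_morphism m (stake ?n w))"
      using Suc.prems(2) unfolding stake_is_bonacci_word[OF w] by simp
    ultimately obtain i where i: "i < ?n" "j = length (bonacci_morphism m (stake i w))"
      by (rule bonacci_image_zero_position)
    have "0 < i" using Suc.prems(1) i(2) by (cases i) auto
    have "sdrop j w = bonacci_image m (sdrop i w)"
      using sdrop_bonacci_image[of m i w] i(2) by (simp add: image_word)
    \<comment> \<open>\<open>|P_(k+1)| + 1\<close> equals the length of the image of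
      \<open>P_k\<close> plus 2, exactly the lookahead that decoding needs.\<close>
    then have "stake (length (bonacci_morphism m (stake ?c w)) + 2) (bonacci_image m (sdrop i w))
        = stake (length (bonacci_morphism m (stake ?c w)) + 2) (bonacci_image m w)"
      using ret by (simp add: image_word stake_bonacci_central)
    moreover have "w \<in> streams {..<m}" using w by (simp add: is_bonacci_word_def)
    ultimately have "stake (Suc ?c) (sdrop i w) = stake (Suc ?c) w"
      by (intro bonacci_image_decode) (auto simp: streams_iff_snth sdrop_snth)
    with Suc.IH[OF \<open>0 < i\<close> i(1)] show False by simp
  qed
qed

text \<open>The upper bound on \<open>b\<close> provides this return, the lower bound excludes
  earlier ones.\<close>

lemma first_return_Suc:
  assumes "length (bonacci_central m k) < b" "b \<le> length (bonacci_central m (Suc k))"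
  shows "first_return w b (length (bonacci_finite m (Suc k)))"
  unfolding first_return_def
proof (intro conjI allI impI)
  show "0 < length (bonacci_finite m (Suc k))"
    using length_bonacci_finite_gt[OF m, of "Suc k"] by linarith
  show "stake b (sdrop (length (bonacci_finite m (Suc k))) w) = stake b w"
    by (rule stake_eq_mono[OF _ assms(2)])
      (simp only: bonacci_central_returns stake_bonacci_central)
  fix i
  assume "0 < i \<and> i < length (bonacci_finite m (Suc k))"
  then show "stake b (sdrop i w) \<noteq> stake b w"
    using no_early_return stake_eq_mono[of b "sdrop i w" w] assms(1) Suc_leI by blast
qed

lemma first_return_0: "first_return w 0 j \<longleftrightarrow> j = 1"
  by (auto simp: first_return_def dest: spec[of _ 1])

lemma length_bonacci_central_ge: "k \<le> length (bonacci_central m k)"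
proof (induction k)
  case (Suc k)
  then show ?case using length_bonacci_finite_gt[OF m, of k] length_bonacci_central_Suc[of m k]
    by linarith
qed simp

text \<open>The least index whose central word reaches length \<open>b\<close> is a successor, as
  \<open>P_0\<close> is empty.\<close>

lemma central_interval:
  assumes "0 < b"
  obtains k where "length (bonacci_central m k) < b" "b \<le> length (bonacci_central m (Suc k))"
proof -
  have "\<exists>k. b \<le> length (bonacci_central m k)" using length_bonacci_central_ge by blast
  then obtain k where k: "b \<le> length (bonacci_central m k)"
    "\<forall>i<k. \<not> b \<le> length (bonacci_central m i)"
    using exists_least_iff[of "\<lambda>k. b \<le> length (bonacci_central m k)"] by blast
  with assms that show ?thesis by (cases k) (auto simp: not_le)
qed

lemma closed_prefix_iff:
  "closed_word (stake n w) \<longleftrightarrow> n = 1 \<or>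
    (\<exists>k. length (bonacci_finite m (Suc k)) + length (bonacci_central m k) < n \<and>
      n \<le> length (bonacci_finite m (Suc k)) + length (bonacci_central m (Suc k)))"
  (is "_ \<longleftrightarrow> n = 1 \<or> (\<exists>k. ?P k)")
proof
  assume "closed_word (stake n w)"
  then obtain b j where n: "n = b + j" and ret: "first_return w b j"
    by (auto simp: closed_stake_iff)
  show "n = 1 \<or> (\<exists>k. ?P k)"
  proof (cases "b = 0")
    case True
    with n ret show ?thesis by (simp add: first_return_0)
  next
    case False
    then obtain k where k: "length (bonacci_central m k) < b" "b \<le> length (bonacci_central m (Suc k))"
      by (auto elim: central_interval)
    have "j = length (bonacci_finite m (Suc k))"
      using first_return_unique[OF ret first_return_Suc[OF k]] .
    with n k have "?P k" by linarith
    then show ?thesis by blast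
  qed
next
  assume "n = 1 \<or> (\<exists>k. ?P k)"
  then show "closed_word (stake n w)"
  proof
    assume "\<exists>k. ?P k"
    then obtain k where k: "?P k" ..
    then have "first_return w (n - length (bonacci_finite m (Suc k)))
        (length (bonacci_finite m (Suc k)))"
      by (intro first_return_Suc) linarith+
    moreover have "n = (n - length (bonacci_finite m (Suc k))) + length (bonacci_finite m (Suc k))"
      using k by linarith
    ultimately show ?thesis unfolding closed_stake_iff by blast
  qed (simp add: closed_word_def)
qed

text \<open>The leading \<open>1\<close> is the block of the one-letter prefix. The next closed
  prefix has length 3, so this block is separate from that of \<open>h_0\<close>, which also has
  length 1.\<close>

lemma block_lengths_oc:
  "block_lengths (oc w) (1 ## smap (\<lambda>i. length (bonacci_finite m i)) nats)"
proof -
  \<comment> \<open>Closed lengths start at \<open>|h_(k+1)| + |P_k| + 1\<close>, and length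
    \<open>n\<close> sits at position \<open>n - 1\<close>. Index 0 is the single letter, so the
    other intervals are shifted by one.\<close>
  define p where "p k = (case k of 0 \<Rightarrow> 0
    | Suc k \<Rightarrow> length (bonacci_finite m (Suc k)) + length (bonacci_central m k))" for k
  define l where "l k = (case k of 0 \<Rightarrow> 1 | Suc k \<Rightarrow> length (bonacci_finite m k))" for k
  have "block_lengths (oc w) (smap l nats)"
  proof (rule block_lengths_intervals)
    show "oc w !! a = 1 \<longleftrightarrow> (\<exists>k. p k \<le> a \<and> a < p k + l k)" for a
    proof -
      have "(\<exists>k. p k \<le> a \<and> a < p k + l k) \<longleftrightarrow>
          (p 0 \<le> a \<and> a < p 0 + l 0) \<or> (\<exists>k. p (Suc k) \<le> a \<and> a < p (Suc k) + l (Suc k))"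
        by (metis not0_implies_Suc)
      also have "\<dots> \<longleftrightarrow> closed_word (stake (Suc a) w)"
        unfolding closed_prefix_iff length_bonacci_central_Suc
        by (simp add: p_def l_def less_Suc_eq_le Suc_le_eq add_ac del: bonacci_finite_simps)
      finally show ?thesis by (simp add: oc_snth)
    qed
    show "0 < l k" for k
      using length_bonacci_finite_gt[OF m, of "k - 1"] by (cases k) (auto simp: l_def)
    show "p k + l k < p (Suc k)" for k
    proof (cases k)
      case 0
      then show ?thesis
        using length_bonacci_finite_gt[OF m, of 1] by (simp add: p_def l_def)
    next
      case (Suc i)
      then show ?thesis
        \<comment> \<open>The interval ends at \<open>|h_(i+1)| + |P_(i+1)|\<close> and the next
          starts at \<open>|h_(i+2)| + |P_(i+1)|\<close>.\<close>
        using length_bonacci_finite_less_Suc[OF m, of "Suc i"]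
        by (simp add: p_def l_def length_bonacci_central_Suc
            del: bonacci_finite_simps bonacci_central.simps)
    qed
  qed
  moreover have "smap l nats = 1 ## smap (\<lambda>i. length (bonacci_finite m i)) nats"
    by (subst stream_eq_iff_snth) (auto simp: l_def snth_Stream split: nat.splits)
  ultimately show ?thesis by simp
qed

end

theorem corollary50:
  fixes m :: nat
  assumes "m \<ge> 2"
  shows "block_lengths (oc (bonacci_word m)) (1 ## smap (\<lambda>i. length (bonacci_finite m i)) nats)"
  using assms by (intro block_lengths_oc bonacci_word)

end
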